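(* Let $R$ be a commutative ring, $\mathcal M$ a category of $R$-modules, and $p$ a pair operation on a class $\mathcal P$ of pairs of $R$-modules in $\mathcal M$. (1) If $p$ is surjection-functorial then $p$ is surjection-cofunctorial. (2) If $p$ is restrictable then $p$ is order-preserving on ambient modules. (3) If $p$ is functorial then it is surjection-functorial and order-preserving on ambient modules. The converse holds if whenever $g:M\to M'$ is in $\mathcal M$ and $(L,M)\in\mathcal P$, we have $(g(L),g(M))\in\mathcal P$. (4) If $p$ is cofunctorial then it is surjection-cofunctorial and restrictable. The converse holds if whenever $g:M\to M'$ is a homomorphism, $L\subseteq M'$, $(L,M'),(g^{-1}(L),M)\in\mathcal P$, and we can write $g=i\circ\pi$ where $\pi$ is surjective and $i$ is injective, then $(i^{-1}(L),\pi(M))\in\mathcal P$. (5) Suppose $p$ is order-preserving on submodules. Then: (a) If for any surjection $\pi:M\to M'$ and $L\subseteq M$ such that $(L,M),(\pi(L),M')\in\mathcal P$ we have $(\pi^{-1}(\pi(L)),M)\in\mathcal P$, then $p$ is surjection-functorial if and only if $p$ is surjection-cofunctorial. (b) If whenever $(L\cap N,N),(L,M)\in\mathcal P$ (with $L,N\subseteq M$) we also have $(L\cap N,M)\in\mathcal P$, then $p$ is order-preserving on ambient modules if and only if $p$ is restrictable. (c) If $p$ is functorial then $p$ is cofunctorial, as long as: whenever $(L\cap N,N),(L,M)\in\mathcal P$ (with $L,N\subseteq M$), $(L\cap N,M)$ is also in $\mathcal P$; and whenever $g:M\to M'$ is a homomorphism, $(L,M'),(g^{-1}(L),M)\in\mathcal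 P$, and we can write $g=i\circ\pi$ where $\pi$ is surjective and $i$ is injective, then $(i^{-1}(L),\pi(M))\in\mathcal P$. The converse (cofunctorial implies functorial) holds if whenever $g:M\to M'$ is in $\mathcal M$ and $(L,M)\in\mathcal P$, we have $(g(L),g(M))\in\mathcal P$, and whenever $\pi:M\to M'$ is a surjection with $(L,M),(\pi(L),M')\in\mathcal P$, we have $(\pi^{-1}(\pi(L)),M)\in\mathcal P$.
   Context: $\mathcal M$ is a category of $R$-modules. $\mathcal P$ is a collection of pairs $(L,M)$, with $L$ a submodule of $M$ and $L,M\in\mathcal M$, such that whenever $\phi:M\to M'$ is an isomorphism in $\mathcal M$ and $(L,M)\in\mathcal P$, then $(\phi(L),M')\in\mathcal P$ as well. A pair operation on $\mathcal P$ is a function $p$ sending each $(L,M)\in\mathcal P$ to a submodule $p(L,M)$ of $M$ such that $\phi(p(L,M))=p(\phi(L),M')$ whenever $\phi:M\to M'$ is an isomorphism in $\mathcal M$ and $(L,M)\in\mathcal P$. The pair operation $p$ is: - order-preserving on submodules if $p(L,M)\subseteq p(N,M)$ whenever $L\subseteq N\subseteq M$ and $(L,M),(N,M)\in\mathcal P$; - order-preserving on ambient modules if $p(L,N)\subseteq p(L,M)$ whenever $L\subseteq N\subseteq M$ and $(L,N),(L,M)\in\mathcal P$; - functorial if $g(p(L,M))\subseteq p(g(L),M')$ whenever $g:M\to M'$ and $(L,M),(g(L),M')\in\mathcal P$; surjection-functorial if this holds whenever $g$ is moreover surjective; - cofunctorial if $p(g^{-1}(L),M)\subseteq g^{-1}(p(L,M'))$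 whenever $g:M\to M'$ and $(L,M'),(g^{-1}(L),M)\in\mathcal P$; surjection-cofunctorial if this holds whenever $g$ is moreover surjective; - restrictable if $p(L\cap N,N)\subseteq p(L,M)$ whenever $L,N\subseteq M$ and $(L\cap N,N),(L,M)\in\mathcal P$.
   Formalization: The category of R-modules is assumed to contain the inclusion N→M for objects N⊆M, and the map M→g(M) whenever g:M→M' is in it and g(M) is an object (true for full subcategories); with only identity morphisms, for example, (3) and (4) fail. *)

theory Defs
  imports "HOL-Algebra.Module"
begin

type_synonym ('r, 'm) pair_set = "('m set \<times> ('r, 'm) module) set"
type_synonym ('r, 'm) hom_sets = "('r, 'm) module \<Rightarrow> ('r, 'm) module \<Rightarrow> ('m \<Rightarrow> 'm) set"
type_synonym ('r, 'm) pair_map = "'m set \<Rightarrow> ('r, 'm) module \<Rightarrow> 'm set"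

definition module_hom ::
  "('r, 'k) ring_scheme \<Rightarrow> ('r, 'm) module \<Rightarrow> ('r, 'm) module \<Rightarrow> ('m \<Rightarrow> 'm) set" where
  "module_hom R M N = {h \<in> hom (add_monoid M) (add_monoid N).
     \<forall>r\<in>carrier R. \<forall>x\<in>carrier M. h (r \<odot>\<^bsub>M\<^esub> x) = r \<odot>\<^bsub>N\<^esub> h x}"

text \<open>
  The relation between modules "N is a submodule of M". It is not the equation
  \<open>N = M\<lparr>carrier := carrier N\<rparr>\<close>, since the record fields \<open>mult\<close> and \<open>one\<close>, and the values of
  the operations outside the carrier, carry no meaning for modules.
\<close>
definition is_submodule ::
  "('r, 'k) ring_scheme \<Rightarrow> ('r, 'm) module \<Rightarrow> ('r, 'm) module \<Rightarrow> bool" where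
  "is_submodule R N M \<longleftrightarrow> module R N \<and> submodule (carrier N) R M \<and>
     (\<forall>x\<in>carrier N. \<forall>y\<in>carrier N. x \<oplus>\<^bsub>N\<^esub> y = x \<oplus>\<^bsub>M\<^esub> y) \<and>
     (\<forall>r\<in>carrier R. \<forall>x\<in>carrier N. r \<odot>\<^bsub>N\<^esub> x = r \<odot>\<^bsub>M\<^esub> x)"

definition image_module :: "('m \<Rightarrow> 'm) \<Rightarrow> ('r, 'm) module \<Rightarrow> ('r, 'm) module \<Rightarrow> ('r, 'm) module" where
  "image_module g M M' = M'\<lparr>carrier := g ` carrier M\<rparr>"

definition preimage :: "('m \<Rightarrow> 'm) \<Rightarrow> ('r, 'm) module \<Rightarrow> 'm set \<Rightarrow> 'm set" where
  "preimage g M L = {x \<in> carrier M. g x \<in> L}"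

definition surj_hom :: "('m \<Rightarrow> 'm) \<Rightarrow> ('r, 'm) module \<Rightarrow> ('r, 'm) module \<Rightarrow> bool" where
  "surj_hom g M M' \<longleftrightarrow> g ` carrier M = carrier M'"

text \<open>
  A category of R-modules is given by its objects and its morphism sets; it need not be full,
  nor closed under isomorphism, submodules or quotients. The last two axioms say that, for
  objects \<open>N \<subseteq> M\<close>, the inclusion is a morphism, and that a morphism whose image is an object is
  also a morphism onto that image. Full subcategories satisfy them (see
  \<open>full_module_category\<close> below). Without the former, functoriality would say nothing about
  inclusions \<open>N \<subseteq> M\<close> of objects; without the latter, surjection-functoriality would say nothing
  about \<open>M \<rightarrow> g(M)\<close>.
\<close>
locale module_category =
  fixes R :: "('r, 'k) ring_scheme"
    and Ob :: "('r, 'm) module set"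
    and Hom :: "('r, 'm) hom_sets"
  assumes ob_module: "M \<in> Ob \<Longrightarrow> module R M"
    and hom_linear: "\<lbrakk>M \<in> Ob; N \<in> Ob; g \<in> Hom M N\<rbrakk> \<Longrightarrow> g \<in> module_hom R M N"
    and id_hom: "M \<in> Ob \<Longrightarrow> (\<lambda>x. x) \<in> Hom M M"
    and comp_hom: "\<lbrakk>M \<in> Ob; N \<in> Ob; Q \<in> Ob; f \<in> Hom M N; g \<in> Hom N Q\<rbrakk> \<Longrightarrow> g \<circ> f \<in> Hom M Q"
    and inclusion_hom: "\<lbrakk>M \<in> Ob; N \<in> Ob; is_submodule R N M\<rbrakk> \<Longrightarrow> (\<lambda>x. x) \<in> Hom N M"
    and corestriction_hom:
      "\<lbrakk>M \<in> Ob; M' \<in> Ob; N \<in> Ob; g \<in> Hom M M'; is_submodule R N M'; carrier N = g ` carrier M\<rbrakk>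
       \<Longrightarrow> g \<in> Hom M N"

lemma full_module_category:
  assumes "\<And>M. M \<in> Ob \<Longrightarrow> module R M"
  shows "module_category R Ob (module_hom R)"
proof (rule module_category.intro)
  fix M N assume "M \<in> Ob" "N \<in> Ob" "is_submodule R N M"
  then show "(\<lambda>x. x) \<in> module_hom R N M"
    unfolding is_submodule_def module_hom_def hom_def
    using subgroup.mem_carrier[of "carrier N" "add_monoid M"]
    by (auto dest: submodule.axioms(1))
next
  fix M N Q f g
  assume "f \<in> module_hom R M N" "g \<in> module_hom R N Q"
  then show "g \<circ> f \<in> module_hom R M Q"
    unfolding module_hom_def hom_def by (auto simp: Pi_iff)
qed (use assms in \<open>auto simp: module_hom_def hom_def is_submodule_def Pi_iff\<close>)

definition iso_in :: "('r, 'm) hom_sets \<Rightarrow> ('m \<Rightarrow> 'm) \<Rightarrow> ('r, 'm) module \<Rightarrow> ('r, 'm) module \<Rightarrow> bool" where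
  "iso_in Hom \<phi> M M' \<longleftrightarrow> \<phi> \<in> Hom M M' \<and>
     (\<exists>\<psi>\<in>Hom M' M. (\<forall>x\<in>carrier M. \<psi> (\<phi> x) = x) \<and> (\<forall>y\<in>carrier M'. \<phi> (\<psi> y) = y))"

locale pair_class = module_category R Ob Hom
  for R :: "('r, 'k) ring_scheme"
    and Ob :: "('r, 'm) module set"
    and Hom :: "('r, 'm) hom_sets" +
  fixes P :: "('r, 'm) pair_set"
  assumes pair_ob: "(L, M) \<in> P \<Longrightarrow> M \<in> Ob"
    and pair_submodule: "(L, M) \<in> P \<Longrightarrow> submodule L R M"
    and pair_iso: "\<lbrakk>(L, M) \<in> P; M' \<in> Ob; iso_in Hom \<phi> M M'\<rbrakk> \<Longrightarrow> (\<phi> ` L, M') \<in> P"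

locale pair_operation = pair_class R Ob Hom P
  for R :: "('r, 'k) ring_scheme"
    and Ob :: "('r, 'm) module set"
    and Hom :: "('r, 'm) hom_sets"
    and P :: "('r, 'm) pair_set" +
  fixes p :: "('r, 'm) pair_map"
  assumes op_submodule: "(L, M) \<in> P \<Longrightarrow> submodule (p L M) R M"
    and op_iso: "\<lbrakk>(L, M) \<in> P; M' \<in> Ob; iso_in Hom \<phi> M M'\<rbrakk> \<Longrightarrow> \<phi> ` p L M = p (\<phi> ` L) M'"

definition order_preserving_sub :: "('r, 'm) pair_set \<Rightarrow> ('r, 'm) pair_map \<Rightarrow> bool" where
  "order_preserving_sub P p \<longleftrightarrow>
     (\<forall>L N M. (L, M) \<in> P \<longrightarrow> (N, M) \<in> P \<longrightarrow> L \<subseteq> N \<longrightarrow> p L M \<subseteq> p N M)"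

definition order_preserving_ambient ::
  "('r, 'k) ring_scheme \<Rightarrow> ('r, 'm) pair_set \<Rightarrow> ('r, 'm) pair_map \<Rightarrow> bool" where
  "order_preserving_ambient R P p \<longleftrightarrow>
     (\<forall>L N M. is_submodule R N M \<longrightarrow> (L, N) \<in> P \<longrightarrow> (L, M) \<in> P \<longrightarrow> p L N \<subseteq> p L M)"

definition functorial ::
  "('r, 'm) hom_sets \<Rightarrow> ('r, 'm) pair_set \<Rightarrow> ('r, 'm) pair_map \<Rightarrow> bool" where
  "functorial Hom P p \<longleftrightarrow>
     (\<forall>M M' g L. g \<in> Hom M M' \<longrightarrow> (L, M) \<in> P \<longrightarrow> (g ` L, M') \<in> P \<longrightarrow> g ` p L M \<subseteq> p (g ` L) M')"

definition surjection_functorial ::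
  "('r, 'm) hom_sets \<Rightarrow> ('r, 'm) pair_set \<Rightarrow> ('r, 'm) pair_map \<Rightarrow> bool" where
  "surjection_functorial Hom P p \<longleftrightarrow>
     (\<forall>M M' g L. g \<in> Hom M M' \<longrightarrow> surj_hom g M M' \<longrightarrow> (L, M) \<in> P \<longrightarrow> (g ` L, M') \<in> P \<longrightarrow>
        g ` p L M \<subseteq> p (g ` L) M')"

definition cofunctorial ::
  "('r, 'm) hom_sets \<Rightarrow> ('r, 'm) pair_set \<Rightarrow> ('r, 'm) pair_map \<Rightarrow> bool" where
  "cofunctorial Hom P p \<longleftrightarrow>
     (\<forall>M M' g L. g \<in> Hom M M' \<longrightarrow> (L, M') \<in> P \<longrightarrow> (preimage g M L, M) \<in> P \<longrightarrow>
        p (preimage g M L) M \<subseteq> preimage g M (p L M'))"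

definition surjection_cofunctorial ::
  "('r, 'm) hom_sets \<Rightarrow> ('r, 'm) pair_set \<Rightarrow> ('r, 'm) pair_map \<Rightarrow> bool" where
  "surjection_cofunctorial Hom P p \<longleftrightarrow>
     (\<forall>M M' g L. g \<in> Hom M M' \<longrightarrow> surj_hom g M M' \<longrightarrow> (L, M') \<in> P \<longrightarrow> (preimage g M L, M) \<in> P \<longrightarrow>
        p (preimage g M L) M \<subseteq> preimage g M (p L M'))"

definition restrictable ::
  "('r, 'k) ring_scheme \<Rightarrow> ('r, 'm) pair_set \<Rightarrow> ('r, 'm) pair_map \<Rightarrow> bool" where
  "restrictable R P p \<longleftrightarrow>
     (\<forall>L N M. is_submodule R N M \<longrightarrow> (L \<inter> carrier N, N) \<in> P \<longrightarrow> (L, M) \<in> P \<longrightarrow>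
        p (L \<inter> carrier N) N \<subseteq> p L M)"

definition image_closed ::
  "('r, 'm) module set \<Rightarrow> ('r, 'm) hom_sets \<Rightarrow> ('r, 'm) pair_set \<Rightarrow> bool" where
  "image_closed Ob Hom P \<longleftrightarrow>
     (\<forall>M M' g L. M' \<in> Ob \<longrightarrow> g \<in> Hom M M' \<longrightarrow> (L, M) \<in> P \<longrightarrow> (g ` L, image_module g M M') \<in> P)"

text \<open>
  The morphism \<open>g\<close> is in the category, but its factorization \<open>g = i \<circ> \<pi>\<close> ranges over all
  R-linear maps through all R-modules \<open>Q = \<pi>(M)\<close>: that \<open>Q\<close> is an object is part of the conclusion
  \<open>(preimage i Q L, Q) \<in> P\<close>. If only factorizations inside the category were considered, the
  condition would be vacuous for categories without images.
\<close>
definition factorization_closed ::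
  "('r, 'k) ring_scheme \<Rightarrow> ('r, 'm) hom_sets \<Rightarrow> ('r, 'm) pair_set \<Rightarrow> bool" where
  "factorization_closed R Hom P \<longleftrightarrow>
     (\<forall>M M' g L Q \<pi> i. g \<in> Hom M M' \<longrightarrow> (L, M') \<in> P \<longrightarrow> (preimage g M L, M) \<in> P \<longrightarrow>
        module R Q \<longrightarrow> \<pi> \<in> module_hom R M Q \<longrightarrow> surj_hom \<pi> M Q \<longrightarrow>
        i \<in> module_hom R Q M' \<longrightarrow> inj_on i (carrier Q) \<longrightarrow> (\<forall>x\<in>carrier M. g x = i (\<pi> x)) \<longrightarrow>
        (preimage i Q L, Q) \<in> P)"

definition saturation_closed :: "('r, 'm) hom_sets \<Rightarrow> ('r, 'm) pair_set \<Rightarrow> bool" where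
  "saturation_closed Hom P \<longleftrightarrow>
     (\<forall>M M' \<pi> L. \<pi> \<in> Hom M M' \<longrightarrow> surj_hom \<pi> M M' \<longrightarrow> (L, M) \<in> P \<longrightarrow> (\<pi> ` L, M') \<in> P \<longrightarrow>
        (preimage \<pi> M (\<pi> ` L), M) \<in> P)"

definition intersection_closed :: "('r, 'k) ring_scheme \<Rightarrow> ('r, 'm) pair_set \<Rightarrow> bool" where
  "intersection_closed R P \<longleftrightarrow>
     (\<forall>L N M. is_submodule R N M \<longrightarrow> (L \<inter> carrier N, N) \<in> P \<longrightarrow> (L, M) \<in> P \<longrightarrow>
        (L \<inter> carrier N, M) \<in> P)"

end

theory Submission
  imports Defs
begin

text \<open>
  An arbitrary morphism \<open>g : M \<rightarrow> M'\<close> is a surjection onto the image module followed by an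
  inclusion of modules. (Co)functoriality therefore splits into a condition on surjections and a
  condition on inclusions \<open>N \<subseteq> M\<close>, the closure conditions on \<open>P\<close> guaranteeing that the
  intermediate pair on the image is available. On surjections the two notions are exchanged by
  \<open>L \<mapsto> \<pi>\<^sup>-\<^sup>1(\<pi>(L)) \<supseteq> L\<close>, on inclusions by \<open>L \<mapsto> L \<inter> N \<subseteq> L\<close>.
\<close>

lemma submodule_image:
  assumes M: "module R M" and M': "module R M'" and g: "g \<in> module_hom R M M'"
  shows "submodule (g ` carrier M) R M'"
proof -
  interpret M: module R M by (rule M)
  interpret M': module R M' by (rule M')
  interpret group_hom "add_monoid M" "add_monoid M'" g
    using g M.a_group M'.a_group
    by (auto simp: module_hom_def group_hom_def group_hom_axioms_def)
  show ?thesis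
  proof (rule submodule.intro)
    show "subgroup (g ` carrier M) (add_monoid M')"
      using img_is_subgroup by simp
    show "submodule_axioms (g ` carrier M) R M'"
    proof (rule submodule_axioms.intro)
      fix r y assume r: "r \<in> carrier R" and "y \<in> g ` carrier M"
      then obtain x where "x \<in> carrier M" "y = g x" by blast
      with g r have "r \<odot>\<^bsub>M'\<^esub> y = g (r \<odot>\<^bsub>M\<^esub> x)" by (simp add: module_hom_def)
      with r \<open>x \<in> carrier M\<close> show "r \<odot>\<^bsub>M'\<^esub> y \<in> g ` carrier M" by simp
    qed
  qed
qed

text \<open>\<open>image_module\<close> replaces only the carrier of \<open>M'\<close>, so the
  operations agree on the nose and closure of the image is all that matters.\<close>

lemma is_submodule_image_module:
  assumes "module R M" "module R M'" "g \<in> module_hom R M M'"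
  shows "is_submodule R (image_module g M M') M'"
  using submodule_image[OF assms] submodule.submodule_is_module[OF submodule_image[OF assms] assms(2)]
  by (simp add: is_submodule_def image_module_def)

lemma submodule_subset: "submodule H R M \<Longrightarrow> H \<subseteq> carrier M"
  using subgroup.subset[of H "add_monoid M"] by (simp add: submodule_def)

context pair_operation
begin

lemma pair_subset: "(L, M) \<in> P \<Longrightarrow> L \<subseteq> carrier M"
  using pair_submodule submodule_subset by blast

lemma op_subset: "(L, M) \<in> P \<Longrightarrow> p L M \<subseteq> carrier M"
  using op_submodule submodule_subset by blast

lemma is_submodule_image_hom:
  assumes "M \<in> Ob" "M' \<in> Ob" "g \<in> Hom M M'"
  shows "is_submodule R (image_module g M M') M'"
  using assms by (intro is_submodule_image_module ob_module hom_linear)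

text \<open>\<open>Hom\<close> need not be full, so linearity of \<open>g\<close> onto its image is
  not enough; \<open>corestriction_hom\<close> makes it a morphism once the image is an
  object.\<close>

lemma image_module_surjection:
  assumes "M \<in> Ob" "M' \<in> Ob" "g \<in> Hom M M'" "image_module g M M' \<in> Ob"
  shows "g \<in> Hom M (image_module g M M')" "surj_hom g M (image_module g M M')"
proof -
  show "g \<in> Hom M (image_module g M M')"
    using corestriction_hom[OF assms(1,2,4,3) is_submodule_image_hom[OF assms(1-3)]]
    by (simp add: image_module_def)
  show "surj_hom g M (image_module g M M')" by (simp add: surj_hom_def image_module_def)
qed

text \<open>A surjection maps the preimage of \<open>L\<close> back onto \<open>L\<close>, so
  functoriality at that preimage already gives the claim.\<close>

lemma surjection_functorial_imp_surjection_cofunctorial: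
  assumes "surjection_functorial Hom P p"
  shows "surjection_cofunctorial Hom P p"
  unfolding surjection_cofunctorial_def
proof (intro allI impI)
  fix M M' g L
  assume g: "g \<in> Hom M M'" "surj_hom g M M'" and P: "(L, M') \<in> P" "(preimage g M L, M) \<in> P"
  have "g ` preimage g M L = L"
    using pair_subset[OF P(1)] g(2) by (auto simp: preimage_def surj_hom_def)
  with assms g P have "g ` p (preimage g M L) M \<subseteq> p L M'"
    by (metis surjection_functorial_def)
  with op_subset[OF P(2)] show "p (preimage g M L) M \<subseteq> preimage g M (p L M')"
    by (auto simp: preimage_def)
qed

lemma surjection_cofunctorial_imp_surjection_functorial:
  assumes "order_preserving_sub P p" "saturation_closed Hom P" "surjection_cofunctorial Hom P p"
  shows "surjection_functorial Hom P p"
  unfolding surjection_functorial_def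
proof (intro allI impI)
  fix M M' g L
  assume g: "g \<in> Hom M M'" "surj_hom g M M'" and P: "(L, M) \<in> P" "(g ` L, M') \<in> P"
  let ?S = "preimage g M (g ` L)"
  \<comment> \<open>The saturation \<open>?S\<close> of \<open>L\<close> is itself a preimage, so
    cofunctoriality applies to it, and it contains \<open>L\<close>, so monotonicity carries the
    bound over to \<open>L\<close>.\<close>
  have S: "(?S, M) \<in> P"
    using assms(2) g P unfolding saturation_closed_def by blast
  have "L \<subseteq> ?S" using pair_subset[OF P(1)] by (auto simp: preimage_def)
  with assms(1) P(1) S have "p L M \<subseteq> p ?S M" unfolding order_preserving_sub_def by blast
  also have "\<dots> \<subseteq> preimage g M (p (g ` L) M')"
    using assms(3) g P(2) S unfolding surjection_cofunctorial_def by blast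
  finally show "g ` p L M \<subseteq> p (g ` L) M'" by (auto simp: preimage_def)
qed

text \<open>This is the case \<open>L \<subseteq> carrier N\<close> of restrictability, where
  intersecting with \<open>N\<close> changes nothing.\<close>

lemma restrictable_imp_order_preserving_ambient:
  assumes "restrictable R P p"
  shows "order_preserving_ambient R P p"
  unfolding order_preserving_ambient_def
proof (intro allI impI)
  fix L N M assume "is_submodule R N M" "(L, N) \<in> P" "(L, M) \<in> P"
  moreover from \<open>(L, N) \<in> P\<close> have "L \<inter> carrier N = L" using pair_subset by blast
  ultimately show "p L N \<subseteq> p L M" using assms unfolding restrictable_def by metis
qed

text \<open>The pair \<open>(L \<inter> carrier N, M)\<close> is the intermediate stop: first the
  ambient module grows, then the submodule.\<close>

lemma order_preserving_ambient_imp_restrictable: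
  assumes "order_preserving_sub P p" "intersection_closed R P" "order_preserving_ambient R P p"
  shows "restrictable R P p"
  unfolding restrictable_def
proof (intro allI impI)
  fix L N M assume N: "is_submodule R N M" and P: "(L \<inter> carrier N, N) \<in> P" "(L, M) \<in> P"
  have I: "(L \<inter> carrier N, M) \<in> P"
    using assms(2) N P unfolding intersection_closed_def by blast
  have "p (L \<inter> carrier N) N \<subseteq> p (L \<inter> carrier N) M"
    using assms(3) N P(1) I unfolding order_preserving_ambient_def by blast
  also have "\<dots> \<subseteq> p L M"
    using assms(1) I P(2) unfolding order_preserving_sub_def by blast
  finally show "p (L \<inter> carrier N) N \<subseteq> p L M" .
qed

lemma functorial_imp_surjection_functorial:
  "functorial Hom P p \<Longrightarrow> surjection_functorial Hom P p"
  unfolding functorial_def surjection_functorial_def by blast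

text \<open>Functoriality is applied to the inclusion of \<open>N\<close> in \<open>M\<close>, a
  morphism by \<open>inclusion_hom\<close>.\<close>

lemma functorial_imp_order_preserving_ambient:
  assumes "functorial Hom P p"
  shows "order_preserving_ambient R P p"
  unfolding order_preserving_ambient_def
proof (intro allI impI)
  fix L N M assume N: "is_submodule R N M" and P: "(L, N) \<in> P" "(L, M) \<in> P"
  have "(\<lambda>x. x) \<in> Hom N M" using N P by (intro inclusion_hom pair_ob)
  with assms P have "(\<lambda>x. x) ` p L N \<subseteq> p ((\<lambda>x. x) ` L) M"
    unfolding functorial_def by (metis image_ident)
  then show "p L N \<subseteq> p L M" by simp
qed

lemma functorialI:
  assumes "image_closed Ob Hom P" "surjection_functorial Hom P p" "order_preserving_ambient R P p"
  shows "functorial Hom P p"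
  unfolding functorial_def
proof (intro allI impI)
  fix M M' g L assume g: "g \<in> Hom M M'" and P: "(L, M) \<in> P" "(g ` L, M') \<in> P"
  note Ob = pair_ob[OF P(1)] pair_ob[OF P(2)]
  let ?Q = "image_module g M M'"
  have Q: "(g ` L, ?Q) \<in> P"
    using assms(1) Ob(2) g P(1) unfolding image_closed_def by blast
  note surj = image_module_surjection[OF Ob g pair_ob[OF Q]]
  have "g ` p L M \<subseteq> p (g ` L) ?Q"
    using assms(2) surj P(1) Q unfolding surjection_functorial_def by blast
  also have "\<dots> \<subseteq> p (g ` L) M'"
    using assms(3) is_submodule_image_hom[OF Ob g] Q P(2)
    unfolding order_preserving_ambient_def by blast
  finally show "g ` p L M \<subseteq> p (g ` L) M'" .
qed

lemma cofunctorial_imp_surjection_cofunctorial: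
  "cofunctorial Hom P p \<Longrightarrow> surjection_cofunctorial Hom P p"
  unfolding cofunctorial_def surjection_cofunctorial_def by blast

lemma preimage_inclusion: "preimage (\<lambda>x. x) N L = L \<inter> carrier N"
  by (auto simp: preimage_def)

lemma cofunctorial_imp_restrictable:
  assumes "cofunctorial Hom P p"
  shows "restrictable R P p"
  unfolding restrictable_def
proof (intro allI impI)
  fix L N M assume N: "is_submodule R N M" and P: "(L \<inter> carrier N, N) \<in> P" "(L, M) \<in> P"
  have "(\<lambda>x. x) \<in> Hom N M" using N P by (intro inclusion_hom pair_ob)
  with assms P have "p (L \<inter> carrier N) N \<subseteq> p L M \<inter> carrier N"
    unfolding cofunctorial_def by (metis preimage_inclusion)
  then show "p (L \<inter> carrier N) N \<subseteq> p L M" by blast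
qed

lemma cofunctorialI:
  assumes "factorization_closed R Hom P" "surjection_cofunctorial Hom P p" "restrictable R P p"
  shows "cofunctorial Hom P p"
  unfolding cofunctorial_def
proof (intro allI impI)
  fix M M' g L assume g: "g \<in> Hom M M'" and P: "(L, M') \<in> P" "(preimage g M L, M) \<in> P"
  note Ob = pair_ob[OF P(2)] pair_ob[OF P(1)]
  let ?Q = "image_module g M M'"
  have sub: "is_submodule R ?Q M'" by (rule is_submodule_image_hom[OF Ob g])
  have cQ: "carrier ?Q = g ` carrier M" by (simp add: image_module_def)
  \<comment> \<open>The factorization used is \<open>g\<close> followed by the identity map. Only
    linearity of the two factors is checked here; that \<open>?Q\<close> is an object comes out of
    \<open>factorization_closed\<close>, and only then is \<open>g\<close> known to be a morphism
    onto \<open>?Q\<close>.\<close>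
  have "module R ?Q" using sub by (simp add: is_submodule_def)
  moreover have "g \<in> module_hom R M ?Q"
    using hom_linear[OF Ob g] by (auto simp: module_hom_def hom_def image_module_def)
  moreover have "surj_hom g M ?Q" by (simp add: surj_hom_def cQ)
  moreover have "(\<lambda>x. x) \<in> module_hom R ?Q M'"
    using hom_linear[OF Ob g] by (auto simp: module_hom_def hom_def image_module_def)
  ultimately have "(preimage (\<lambda>x. x) ?Q L, ?Q) \<in> P"
    using assms(1) g P unfolding factorization_closed_def by (metis inj_on_id2)
  then have Q: "(L \<inter> carrier ?Q, ?Q) \<in> P" by (simp only: preimage_inclusion)
  note surj = image_module_surjection[OF Ob g pair_ob[OF Q]]
  \<comment> \<open>Preimages see only the part of \<open>L\<close> inside the image, so
    cofunctoriality of the surjection speaks about the original preimage.\<close>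
  have pre: "preimage g M (L \<inter> carrier ?Q) = preimage g M L"
    by (auto simp: preimage_def cQ)
  have "p (preimage g M L) M \<subseteq> preimage g M (p (L \<inter> carrier ?Q) ?Q)"
    using assms(2) surj Q P(2) pre unfolding surjection_cofunctorial_def by metis
  moreover have "p (L \<inter> carrier ?Q) ?Q \<subseteq> p L M'"
    using assms(3) sub Q P(1) unfolding restrictable_def by blast
  ultimately show "p (preimage g M L) M \<subseteq> preimage g M (p L M')"
    by (auto simp: preimage_def)
qed

end

theorem proposition3p5:
  fixes R :: "('r, 'k) ring_scheme"
    and Ob :: "('r, 'm) module set"
    and Hom :: "('r, 'm) module \<Rightarrow> ('r, 'm) module \<Rightarrow> ('m \<Rightarrow> 'm) set"
    and P :: "('m set \<times> ('r, 'm) module) set"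
    and p :: "'m set \<Rightarrow> ('r, 'm) module \<Rightarrow> 'm set"
  assumes "cring R"
    and "pair_operation R Ob Hom P p"
  shows
    "(surjection_functorial Hom P p \<longrightarrow> surjection_cofunctorial Hom P p) \<and>
     (restrictable R P p \<longrightarrow> order_preserving_ambient R P p) \<and>
     (functorial Hom P p \<longrightarrow>
        surjection_functorial Hom P p \<and> order_preserving_ambient R P p) \<and>
     (image_closed Ob Hom P \<longrightarrow>
        surjection_functorial Hom P p \<and> order_preserving_ambient R P p \<longrightarrow>
        functorial Hom P p) \<and>
     (cofunctorial Hom P p \<longrightarrow>
        surjection_cofunctorial Hom P p \<and> restrictable R P p) \<and>
     (factorization_closed R Hom P \<longrightarrow>
        surjection_cofunctorial Hom P p \<and> restrictable R P p \<longrightarrow>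
        cofunctorial Hom P p) \<and>
     (order_preserving_sub P p \<longrightarrow>
        (saturation_closed Hom P \<longrightarrow>
           (surjection_functorial Hom P p \<longleftrightarrow> surjection_cofunctorial Hom P p)) \<and>
        (intersection_closed R P \<longrightarrow>
           (order_preserving_ambient R P p \<longleftrightarrow> restrictable R P p)) \<and>
        (intersection_closed R P \<and> factorization_closed R Hom P \<longrightarrow>
           functorial Hom P p \<longrightarrow> cofunctorial Hom P p) \<and>
        (image_closed Ob Hom P \<and> saturation_closed Hom P \<longrightarrow>
           cofunctorial Hom P p \<longrightarrow> functorial Hom P p))"
proof -
  interpret pair_operation R Ob Hom P p by (rule assms(2))
  show ?thesis
    \<comment> \<open>What remains is propositional. The last two implications split the hypothesis
      into its surjection and inclusion halves, convert each half, and recombine them.\<close>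
    using surjection_functorial_imp_surjection_cofunctorial
      surjection_cofunctorial_imp_surjection_functorial
      restrictable_imp_order_preserving_ambient order_preserving_ambient_imp_restrictable
      functorialI functorial_imp_surjection_functorial
      functorial_imp_order_preserving_ambient cofunctorialI
      cofunctorial_imp_surjection_cofunctorial cofunctorial_imp_restrictable
    by argo
qed

end
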